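(* Let $n\ge1$ and $0\le k\le n-1$ be integers. For any permutation $\sigma\in S_n$, $$\sum_{p\in\varphi_k^{-1}(\sigma)} q^{\mathtt{area}_k(p)}=\prod_{i=1}^n [\ell_k(i;\sigma)]_q.$$
   Context: Write $[n]=\{1,\dots,n\}$. A street has parking spots $1,\dots,n$ in order, and cars $c_1,\dots,c_n$ arrive in this order. A parking preference is a tuple $\alpha=(a_1,\dots,a_n)\in[n]^n$, where $a_i$ is the preferred spot of $c_i$. $k$-Naples parking rule: car $c_i$ drives to spot $a_i$; if it is empty, $c_i$ parks there. If it is occupied, $c_i$ backs up one spot at a time, checking spots $a_i-1,a_i-2,\dots$ in turn, up to at most $k$ spots behind $a_i$ (and never past spot $1$), and parks in the first empty one it finds. If all of these spots are occupied, $c_i$ goes forward and parks in the first empty spot after $a_i$, if there is one; otherwise it fails to park. The preference $\alpha$ is a $k$-Naples parking function of length $n$ if all $n$ cars park under this rule; $PF_{n,k}$ is the set of all of these. $S_n$ is the symmetric group on $[n]$, with permutations in one-line notation. The map $\varphi_k:PF_{n,k}\to S_n$ sends $\alpha$ to $s_1s_2\cdots s_n$, where spot $i$ is occupied by car $c_{s_i}$ after all cars have parked under the $k$-Naples rule. $\varphi_k^{-1}(\sigma)\subseteq PF_{n,k}$ denotes the fiber. For $\sigma=s_1\cdots s_n\in S_n$ and $1\le i\le n$ (subsequences here are blocks of consecutive entries): - $\mathtt{left}_k(i;\sigma)$ is the length of the longest subsequence $s_j\cdots s_{i-1}$ such that $s_t<s_i$ for all $j\le t<i$ (equal to $0$ if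 it is empty). - $\mathtt{right}_k(i;\sigma)$ is the length of the longest subsequence $s_i\cdots s_r$ such that $r\le i+k$ (and $r\le n$) and $s_t\le s_i$ for all $i\le t\le r$. - $\ell_k(i;\sigma)=\mathtt{left}_k(i;\sigma)+\mathtt{right}_k(i;\sigma)$ if $\mathtt{left}_k(i;\sigma)=i-1$, and $\ell_k(i;\sigma)=\max(\mathtt{left}_k(i;\sigma)-k,0)+\mathtt{right}_k(i;\sigma)$ if $\mathtt{left}_k(i;\sigma)<i-1$. The $k$-Naples area of $\alpha=(a_1,\dots,a_n)\in PF_{n,k}$ is $$\mathtt{area}_k(\alpha)=\sum_{i=1}^n\left[n-i+\mathtt{right}_k(i;\varphi_k(\alpha))-a_i\right].$$ For a positive integer $m$, $[m]_q=1+q+\cdots+q^{m-1}$, where $q$ is an indeterminate. *)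

theory Defs
  imports
    "HOL-Library.FuncSet"
    "HOL-Combinatorics.Permutations"
    "HOL-Computational_Algebra.Formal_Laurent_Series"
begin

text \<open>
  Spots and cars are numbered from 1 to n. A preference is an extensional function on
  \<open>{1..n}\<close>, so that distinct preferences are distinct functions; a permutation is a
  function that \<open>permutes {1..n}\<close>, with one-line notation \<open>\<sigma> 1, \<dots>, \<sigma> n\<close>.
\<close>

definition preferences :: "nat \<Rightarrow> (nat \<Rightarrow> nat) set" where
  "preferences n = {1..n} \<rightarrow>\<^sub>E {1..n}"

text \<open>\<open>occ\<close> is the set of occupied spots and \<open>a\<close> the preferred spot; \<open>d\<close> counts the spots
  backed up, where \<open>d < a\<close> prevents passing spot 1. The result is \<open>None\<close> if the car fails.\<close>

definition naples_spot :: "nat \<Rightarrow> nat \<Rightarrow> nat set \<Rightarrow> nat \<Rightarrow> nat option" where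
  "naples_spot n k occ a =
    (if a \<notin> occ then Some a
     else if \<exists>d. 1 \<le> d \<and> d \<le> k \<and> d < a \<and> a - d \<notin> occ
       then Some (a - (LEAST d. 1 \<le> d \<and> d \<le> k \<and> d < a \<and> a - d \<notin> occ))
     else if \<exists>j. a < j \<and> j \<le> n \<and> j \<notin> occ
       then Some (LEAST j. a < j \<and> j \<le> n \<and> j \<notin> occ)
     else None)"

text \<open>The street after the first \<open>c\<close> cars have arrived, as a partial map from spots to cars.\<close>

primrec naples_street :: "nat \<Rightarrow> nat \<Rightarrow> (nat \<Rightarrow> nat) \<Rightarrow> nat \<Rightarrow> (nat \<rightharpoonup> nat)" where
  "naples_street n k \<alpha> 0 = Map.empty"
| "naples_street n k \<alpha> (Suc c) =
    (let st = naples_street n k \<alpha> c in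
     case naples_spot n k (dom st) (\<alpha> (Suc c)) of
       None \<Rightarrow> st
     | Some s \<Rightarrow> st(s \<mapsto> Suc c))"

definition naples_PF :: "nat \<Rightarrow> nat \<Rightarrow> (nat \<Rightarrow> nat) set" where
  "naples_PF n k =
    {\<alpha> \<in> preferences n. \<forall>c\<in>{1..n}. c \<in> ran (naples_street n k \<alpha> n)}"

text \<open>The outcome map. It is the identity outside \<open>{1..n}\<close>, as \<open>permutes\<close> requires.\<close>

definition naples_outcome :: "nat \<Rightarrow> nat \<Rightarrow> (nat \<Rightarrow> nat) \<Rightarrow> (nat \<Rightarrow> nat)" where
  "naples_outcome n k \<alpha> =
    (\<lambda>i. if i \<in> {1..n} then the (naples_street n k \<alpha> n i) else i)"

definition naples_fiber :: "nat \<Rightarrow> nat \<Rightarrow> (nat \<Rightarrow> nat) \<Rightarrow> (nat \<Rightarrow> nat) set" where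
  "naples_fiber n k \<sigma> = {\<alpha> \<in> naples_PF n k. naples_outcome n k \<alpha> = \<sigma>}"

text \<open>The block \<open>\<sigma> j, \<dots>, \<sigma> (i - 1)\<close> is empty for \<open>j = i\<close>. This length does not depend on \<open>k\<close>.\<close>

definition naples_left :: "(nat \<Rightarrow> nat) \<Rightarrow> nat \<Rightarrow> nat" where
  "naples_left \<sigma> i =
    Max {i - j | j. 1 \<le> j \<and> j \<le> i \<and> (\<forall>t. j \<le> t \<and> t < i \<longrightarrow> \<sigma> t < \<sigma> i)}"

definition naples_right :: "nat \<Rightarrow> nat \<Rightarrow> (nat \<Rightarrow> nat) \<Rightarrow> nat \<Rightarrow> nat" where
  "naples_right n k \<sigma> i =
    Max {r + 1 - i | r. i \<le> r \<and> r \<le> i + k \<and> r \<le> n \<and> (\<forall>t. i \<le> t \<and> t \<le> r \<longrightarrow> \<sigma> t \<le> \<sigma> i)}"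

text \<open>Truncated subtraction on \<open>nat\<close> expresses \<open>max (left - k) 0\<close>.\<close>

definition naples_ell :: "nat \<Rightarrow> nat \<Rightarrow> (nat \<Rightarrow> nat) \<Rightarrow> nat \<Rightarrow> nat" where
  "naples_ell n k \<sigma> i =
    (if naples_left \<sigma> i = i - 1 then naples_left \<sigma> i + naples_right n k \<sigma> i
     else (naples_left \<sigma> i - k) + naples_right n k \<sigma> i)"

definition naples_area :: "nat \<Rightarrow> nat \<Rightarrow> (nat \<Rightarrow> nat) \<Rightarrow> int" where
  "naples_area n k \<alpha> =
    (\<Sum>i=1..n. int n - int i + int (naples_right n k (naples_outcome n k \<alpha>) i) - int (\<alpha> i))"

definition q_number :: "'a::comm_semiring_1 \<Rightarrow> nat \<Rightarrow> 'a" where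
  "q_number q m = (\<Sum>j<m. q ^ j)"

text \<open>The area is an integer whose individual summands may be negative. The indeterminate is
  therefore taken in the field of formal Laurent series, where every integer power exists.\<close>

abbreviation q_indet :: "rat fls" where
  "q_indet \<equiv> fls_X"

end

theory Submission
  imports Defs
begin

text \<open>
  If the outcome is \<open>\<sigma>\<close>, then car \<open>\<sigma> i\<close> finds exactly the spots \<open>t\<close> with \<open>\<sigma> t < \<sigma> i\<close> occupied,
  whatever the preferences are. Hence the preference of each car can be chosen independently of
  the others. The preferences that lead car \<open>\<sigma> i\<close> to spot \<open>i\<close> form an interval of length
  \<open>\<ell>\<^sub>k(i; \<sigma>)\<close> with largest element \<open>i + right\<^sub>k(i; \<sigma>) - 1\<close>: to the right they are limited by
  the backing range \<open>k\<close>; to the left, a preference in the occupied block leads forward to \<open>i\<close>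
  unless the car can back up to the empty spot before the block, if there is one. The area is
  the total distance of the preferences from these largest elements, so that the generating
  function factors.
\<close>

section \<open>Parking of a single car\<close>

text \<open>Inverts the parking rule at a free spot \<open>i\<close>: the disjuncts are direct
  parking, backing up and going forward. The minima of the rule turn into conditions on occupied
  intervals, which can be compared with the block lengths.\<close>

lemma naples_spot_eq_Some_iff:
  assumes i: "1 \<le> i" "i \<le> n" "i \<notin> occ" and a: "1 \<le> a" 
  shows "naples_spot n k occ a = Some i \<longleftrightarrow>
    a = i \<or> (i < a \<and> a \<le> i + k \<and> {i<..a} \<subseteq> occ) \<or>
    (a < i \<and> {a..<i} \<subseteq> occ \<and> (\<forall>d. 1 \<le> d \<and> d \<le> k \<and> d < a \<longrightarrow> a - d \<in> occ))"
proof -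
  let ?P = "\<lambda>d. 1 \<le> d \<and> d \<le> k \<and> d < a \<and> a - d \<notin> occ"
  let ?Q = "\<lambda>j. a < j \<and> j \<le> n \<and> j \<notin> occ"
  consider "a \<notin> occ" | "a \<in> occ" "\<exists>d. ?P d" | "a \<in> occ" "\<not> (\<exists>d. ?P d)" by blast
  then show ?thesis
  proof cases
    case 1
    then show ?thesis using i by (auto simp: naples_spot_def)
  next
    case 2
    define m where "m = (LEAST d. ?P d)"
    have m: "?P m" unfolding m_def using LeastI_ex[OF 2(2)] .
    have below: "\<not> ?P d" if "d < m" for d using not_less_Least that unfolding m_def by blast
    have eq: "naples_spot n k occ a = Some (a - m)"
      unfolding naples_spot_def m_def using 2 by simp
    have "a - m = i \<longleftrightarrow> i < a \<and> a \<le> i + k \<and> {i<..a} \<subseteq> occ"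
    proof
      assume im: "a - m = i"
      \<comment> \<open>The spot \<open>t\<close> is checked after backing up \<open>a - t\<close>
        spots, fewer than \<open>m\<close>; \<open>t = a\<close> is separate because distance 0 is
        not among the backward checks.\<close>
      have "t \<in> occ" if "i < t" "t \<le> a" for t
        using below[of "a - t"] that im m 2(1) i by (cases "t = a") auto
      then show "i < a \<and> a \<le> i + k \<and> {i<..a} \<subseteq> occ" using im m by auto
    next
      assume R: "i < a \<and> a \<le> i + k \<and> {i<..a} \<subseteq> occ"
      then have "?P (a - i)" using i by auto
      then have "m \<le> a - i" unfolding m_def by (rule Least_le)
      \<comment> \<open>Minimality of \<open>m\<close> gives \<open>a - m\<close> at least
        \<open>i\<close>; the occupied run excludes anything larger.\<close>
      moreover have "a - m \<notin> {i<..a}" using R m by blast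
      ultimately show "a - m = i" using R by auto
    qed
    moreover have "a \<noteq> i" using 2(1) i by auto
    ultimately show ?thesis using eq m by auto
  next
    case 3
    have ai: "a \<noteq> i" using 3(1) i by auto
    have no_right: "\<not> (i < a \<and> a \<le> i + k)"
    proof
      assume "i < a \<and> a \<le> i + k"
      then have "?P (a - i)" using i by auto
      then show False using 3 by blast
    qed
    have behind: "\<forall>d. 1 \<le> d \<and> d \<le> k \<and> d < a \<longrightarrow> a - d \<in> occ" using 3 by blast
    show ?thesis
    proof (cases "\<exists>j. ?Q j")
      case True
      define m where "m = (LEAST j. ?Q j)"
      have m: "?Q m" unfolding m_def using LeastI_ex[OF True] .
      have below: "\<not> ?Q j" if "j < m" for j using not_less_Least that unfolding m_def by blast
      have eq: "naples_spot n k occ a = Some m"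
        unfolding naples_spot_def m_def using 3 True by auto
      have "m = i \<longleftrightarrow> a < i \<and> {a..<i} \<subseteq> occ"
      proof
        assume "m = i"
        then have "t \<in> occ" if "a \<le> t" "t < i" for t
          using below[of t] that m 3(1) by (cases "t = a") auto
        then show "a < i \<and> {a..<i} \<subseteq> occ" using m \<open>m = i\<close> by auto
      next
        assume R: "a < i \<and> {a..<i} \<subseteq> occ"
        then have "m \<le> i" unfolding m_def using i by (intro Least_le) auto
        moreover have "m \<notin> {a..<i}" using R m by blast
        ultimately show "m = i" using m by auto
      qed
      then show ?thesis using eq ai no_right behind by auto
    next
      case False
      then have "naples_spot n k occ a = None"
        unfolding naples_spot_def using 3 by simp
      \<comment> \<open>Otherwise \<open>i\<close> itself would be a free spot ahead of
        \<open>a\<close>.\<close>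
      moreover have "\<not> a < i" using False i by blast
      ultimately show ?thesis using ai no_right by auto
    qed
  qed
qed

lemma naples_spot_SomeD:
  assumes "naples_spot n k occ a = Some s" "a \<in> {1..n}"
  shows "s \<in> {1..n} - occ"
proof (cases "a \<in> occ")
  case False
  then show ?thesis using assms by (auto simp: naples_spot_def)
next
  case occ: True
  let ?P = "\<lambda>d. 1 \<le> d \<and> d \<le> k \<and> d < a \<and> a - d \<notin> occ"
  let ?Q = "\<lambda>j. a < j \<and> j \<le> n \<and> j \<notin> occ"
  show ?thesis
  proof (cases "\<exists>d. ?P d")
    case True
    then have "s = a - (LEAST d. ?P d)" using assms occ by (simp add: naples_spot_def)
    then show ?thesis using LeastI_ex[OF True] assms(2) by auto
  next
    case False
    then have ex: "\<exists>j. ?Q j" 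
      using assms occ unfolding naples_spot_def by (auto split: if_splits)
    have "naples_spot n k occ a = Some (LEAST j. ?Q j)"
      unfolding naples_spot_def using occ False ex by auto
    then have "s = (LEAST j. ?Q j)" using assms by simp
    then show ?thesis using LeastI_ex[OF ex] assms(2) by auto
  qed
qed

section \<open>Block lengths and the interval of preferences\<close>

text \<open>The first two facts hold because the maximum is attained, at some \<open>j\<close>. The
  third is maximality: if \<open>j\<close> exceeds 1 and car \<open>\<sigma> (j - 1)\<close> were
  smaller as well, the block could be extended.\<close>

lemma naples_left_props:
  assumes "1 \<le> i"
  shows "naples_left \<sigma> i \<le> i - 1"
    and "\<And>t. i - naples_left \<sigma> i \<le> t \<Longrightarrow> t < i \<Longrightarrow> \<sigma> t < \<sigma> i"
    and "naples_left \<sigma> i < i - 1 \<Longrightarrow> \<not> \<sigma> (i - naples_left \<sigma> i - 1) < \<sigma> i"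
proof -
  let ?S = "{i - j | j. 1 \<le> j \<and> j \<le> i \<and> (\<forall>t. j \<le> t \<and> t < i \<longrightarrow> \<sigma> t < \<sigma> i)}"
  have fin: "finite ?S" by (rule finite_subset[of _ "{..i}"]) auto
  have "i - i \<in> ?S" using assms by (intro CollectI exI[of _ i]) auto
  then have "naples_left \<sigma> i \<in> ?S" unfolding naples_left_def using fin by (intro Max_in) auto
  then obtain j where j: "naples_left \<sigma> i = i - j" "1 \<le> j" "j \<le> i"
    "\<forall>t. j \<le> t \<and> t < i \<longrightarrow> \<sigma> t < \<sigma> i" by blast
  show "naples_left \<sigma> i \<le> i - 1" using j by simp
  show "\<sigma> t < \<sigma> i" if "i - naples_left \<sigma> i \<le> t" "t < i" for t using j that by simp
  show "\<not> \<sigma> (i - naples_left \<sigma> i - 1) < \<sigma> i" if "naples_left \<sigma> i < i - 1"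
  proof
    assume less: "\<sigma> (i - naples_left \<sigma> i - 1) < \<sigma> i"
    have "\<sigma> t < \<sigma> i" if "j - 1 \<le> t" "t < i" for t
      using less j that by (cases "t = j - 1") auto
    then have "i - (j - 1) \<in> ?S" using j that by (intro CollectI exI[of _ "j - 1"]) auto
    then have "i - (j - 1) \<le> naples_left \<sigma> i"
      unfolding naples_left_def using fin by (intro Max_ge) auto
    then show False using j by auto
  qed
qed

lemma naples_right_props:
  assumes "1 \<le> i" "i \<le> n"
  shows "1 \<le> naples_right n k \<sigma> i" 
    and "naples_right n k \<sigma> i \<le> k + 1"
    and "i + naples_right n k \<sigma> i \<le> n + 1"
    and "\<And>t. i \<le> t \<Longrightarrow> t < i + naples_right n k \<sigma> i \<Longrightarrow> \<sigma> t \<le> \<sigma> i"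
    and "\<And>r. \<lbrakk>i \<le> r; r \<le> i + k; r \<le> n; \<forall>t. i \<le> t \<and> t \<le> r \<longrightarrow> \<sigma> t \<le> \<sigma> i\<rbrakk>
           \<Longrightarrow> r < i + naples_right n k \<sigma> i"
proof -
  let ?S = "{r + 1 - i | r. i \<le> r \<and> r \<le> i + k \<and> r \<le> n \<and>
    (\<forall>t. i \<le> t \<and> t \<le> r \<longrightarrow> \<sigma> t \<le> \<sigma> i)}"
  have fin: "finite ?S" by (rule finite_subset[of _ "{..n + 1}"]) auto
  have "i + 1 - i \<in> ?S" using assms by (intro CollectI exI[of _ i]) auto
  then have "naples_right n k \<sigma> i \<in> ?S" unfolding naples_right_def using fin by (intro Max_in) auto
  then obtain r where r: "naples_right n k \<sigma> i = r + 1 - i" "i \<le> r" "r \<le> i + k" "r \<le> n"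
    "\<forall>t. i \<le> t \<and> t \<le> r \<longrightarrow> \<sigma> t \<le> \<sigma> i" by blast
  show "1 \<le> naples_right n k \<sigma> i" "naples_right n k \<sigma> i \<le> k + 1"
    "i + naples_right n k \<sigma> i \<le> n + 1" using r by auto
  show "\<sigma> t \<le> \<sigma> i" if "i \<le> t" "t < i + naples_right n k \<sigma> i" for t using r that by auto
  show "r' < i + naples_right n k \<sigma> i"
    if "i \<le> r'" "r' \<le> i + k" "r' \<le> n" "\<forall>t. i \<le> t \<and> t \<le> r' \<longrightarrow> \<sigma> t \<le> \<sigma> i" for r'
  proof -
    have "r' + 1 - i \<in> ?S" using that by blast
    then have "r' + 1 - i \<le> naples_right n k \<sigma> i"
      unfolding naples_right_def using fin by (intro Max_ge) auto
    then show ?thesis using that by auto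
  qed
qed

text \<open>Keeps the lower end of the interval of preferences at 1 or above, so that the truncated
  subtraction in it is exact.\<close>

lemma naples_ell_le:
  assumes "1 \<le> i"
  shows "naples_ell n k \<sigma> i + 1 \<le> i + naples_right n k \<sigma> i"
  using naples_left_props(1)[OF assms, of \<sigma>] assms by (auto simp: naples_ell_def)

lemma naples_spot_eq_Some_iff_interval:
  assumes \<sigma>: "\<sigma> permutes {1..n}" and i: "i \<in> {1..n}" and a: "a \<in> {1..n}"
  shows "naples_spot n k {t \<in> {1..n}. \<sigma> t < \<sigma> i} a = Some i \<longleftrightarrow>
    a \<in> {i + naples_right n k \<sigma> i - naples_ell n k \<sigma> i ..< i + naples_right n k \<sigma> i}"
proof -
  define L R where "L = naples_left \<sigma> i" and "R = naples_right n k \<sigma> i"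
  let ?occ = "{t \<in> {1..n}. \<sigma> t < \<sigma> i}"
  have i': "1 \<le> i" "i \<le> n" using i by auto
  note left = naples_left_props[OF i'(1), of \<sigma>, folded L_def]
  note right = naples_right_props[OF i', where k = k and \<sigma> = \<sigma>, folded R_def]
  \<comment> \<open>The block of \<open>naples_right\<close> contains \<open>i\<close> itself and so
    uses a non-strict comparison; injectivity makes it strict beyond \<open>i\<close>, as occupation
    requires.\<close>
  have inj: "\<sigma> t \<noteq> \<sigma> i" if "t \<noteq> i" for t using permutes_inj[OF \<sigma>] that by (auto dest: injD)
  have right_iff: "a \<le> i + k \<and> {i<..a} \<subseteq> ?occ \<longleftrightarrow> a < i + R" if "i < a"
  proof
    assume A: "a \<le> i + k \<and> {i<..a} \<subseteq> ?occ"
    have "\<sigma> t \<le> \<sigma> i" if "i \<le> t" "t \<le> a" for t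
      using A that by (cases "t = i") (auto dest!: subsetD[of _ _ t])
    then show "a < i + R" using A that a by (intro right(5)) auto
  next
    assume A: "a < i + R"
    have "\<sigma> t < \<sigma> i" if "i < t" "t \<le> a" for t
      using right(4)[of t] inj[of t] A that by auto
    then show "a \<le> i + k \<and> {i<..a} \<subseteq> ?occ" using A right(2) i' a by auto
  qed
  \<comment> \<open>If \<open>L = i - 1\<close>, the occupied block reaches spot 1 and backing up
    always fails. Otherwise spot \<open>i - L - 1\<close> is free and must lie more than
    \<open>k\<close> behind \<open>a\<close>, which is the bound
    \<open>i - L + k \<le> a\<close>.\<close>
  have left_iff: "{a..<i} \<subseteq> ?occ \<and> (\<forall>d. 1 \<le> d \<and> d \<le> k \<and> d < a \<longrightarrow> a - d \<in> ?occ)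
    \<longleftrightarrow> L = i - 1 \<or> i - L + k \<le> a" (is "?A \<longleftrightarrow> ?B") if ai: "a < i"
  proof
    assume A: ?A
    show ?B
    proof (rule ccontr)
      assume "\<not> ?B"
      then have L: "L < i - 1" and lt: "a < i - L + k" using left(1) by auto
      define e where "e = i - L - 1"
      have e: "1 \<le> e" "e < i" "e \<notin> ?occ" using left(3)[OF L] L i' unfolding e_def by auto
      \<comment> \<open>Were \<open>a\<close> at most \<open>e\<close>, the occupied run from
        \<open>a\<close> up to \<open>i\<close> would contain the free spot
        \<open>e\<close>.\<close>
      have "e < a" using A e ai by (meson atLeastLessThan_iff not_less subsetD)
      moreover have "a - e \<le> k" using lt e unfolding e_def by auto
      ultimately have "1 \<le> a - e \<and> a - e \<le> k \<and> a - e < a" using e by auto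
      then have "a - (a - e) \<in> ?occ" using A by blast
      then show False using e \<open>e < a\<close> by auto
    qed
  next
    assume B: ?B
    have occ: "t \<in> ?occ" if "1 \<le> t" "i - L \<le> t" "t < i" for t
      using left(2)[of t] that i' by auto
    show ?A
    proof (intro conjI allI impI subsetI)
      fix t assume "t \<in> {a..<i}"
      then show "t \<in> ?occ" using B a left(1) i' by (intro occ) auto
    next
      fix d assume "1 \<le> d \<and> d \<le> k \<and> d < a"
      then show "a - d \<in> ?occ" using B a ai left(1) i' by (intro occ) auto
    qed
  qed
  have ell: "naples_ell n k \<sigma> i = (if L = i - 1 then L + R else (L - k) + R)"
    unfolding naples_ell_def L_def R_def ..
  have "i \<notin> ?occ" by simp
  from naples_spot_eq_Some_iff[OF i' this, of a k]
  have "naples_spot n k ?occ a = Some i \<longleftrightarrow>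
    a = i \<or> (i < a \<and> a < i + R) \<or> (a < i \<and> (L = i - 1 \<or> i - L + k \<le> a))"
    using right_iff left_iff a by (cases a i rule: linorder_cases) auto
  \<comment> \<open>When \<open>L < i - 1\<close> and \<open>L \<le> k\<close>, no preference below
    \<open>i\<close> qualifies, in agreement with the truncated \<open>L - k = 0\<close>.\<close>
  also have "\<dots> \<longleftrightarrow> a \<in> {i + R - naples_ell n k \<sigma> i ..< i + R}"
    unfolding ell using left(1) right(1) a i' by (auto split: if_splits)
  finally show ?thesis unfolding R_def .
qed

section \<open>The street over time\<close>

lemma naples_street_SomeD:
  "naples_street n k \<alpha> c t = Some s \<Longrightarrow> 1 \<le> s \<and> s \<le> c"
  by (induction c) (auto simp: Let_def split: option.splits if_splits)

lemma naples_street_dom: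
  assumes "\<alpha> \<in> preferences n" "c \<le> n"
  shows "dom (naples_street n k \<alpha> c) \<subseteq> {1..n}"
  using assms(2)
proof (induction c)
  case (Suc c)
  have "\<alpha> (Suc c) \<in> {1..n}" using assms Suc.prems by (auto simp: preferences_def)
  then show ?case using Suc
    by (auto simp: Let_def split: option.splits if_splits dest!: naples_spot_SomeD)
qed auto

text \<open>A new car only takes an empty spot, so no entry is ever overwritten, and later cars
  carry larger numbers. Every intermediate street can thus be read off a later one.\<close>

lemma naples_street_restrict:
  assumes "\<alpha> \<in> preferences n" "c \<le> m" "m \<le> n"
  shows "naples_street n k \<alpha> c t = Some s \<longleftrightarrow> naples_street n k \<alpha> m t = Some s \<and> s \<le> c"
  using assms(2,3)
proof (induction m rule: dec_induct)
  case base
  then show ?case using naples_street_SomeD by blast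
next
  case (step m)
  have "\<alpha> (Suc m) \<in> {1..n}" using assms step by (auto simp: preferences_def)
  then show ?case using step
    by (auto simp: Let_def split: option.splits if_splits dest!: naples_spot_SomeD)
qed

section \<open>Fibers of the outcome map\<close>

text \<open>In one direction the street met by each car is recovered from the final street
  \<open>\<sigma>\<close>; in the other the street is built up by induction on the number of
  cars.\<close>

lemma naples_fiber_eq:
  assumes \<sigma>: "\<sigma> permutes {1..n}"
  shows "naples_fiber n k \<sigma> = {\<alpha> \<in> preferences n.
    \<forall>i\<in>{1..n}. naples_spot n k {t \<in> {1..n}. \<sigma> t < \<sigma> i} (\<alpha> (\<sigma> i)) = Some i}"
proof (intro equalityI subsetI)
  fix \<alpha> assume fib: "\<alpha> \<in> naples_fiber n k \<sigma>"
  then have pref: "\<alpha> \<in> preferences n"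
    and cars: "\<forall>c\<in>{1..n}. c \<in> ran (naples_street n k \<alpha> n)"
    and out: "naples_outcome n k \<alpha> = \<sigma>"
    by (auto simp: naples_fiber_def naples_PF_def)
  let ?st = "naples_street n k \<alpha>"
  \<comment> \<open>The outcome is defined with \<open>the\<close> and determines the street only at
    occupied spots. Since \<open>n\<close> different cars are parked, all \<open>n\<close> spots are
    occupied.\<close>
  have dom_n: "dom (?st n) = {1..n}"
  proof (rule card_seteq)
    show sub: "dom (?st n) \<subseteq> {1..n}" using naples_street_dom[OF pref] by simp
    have "{1..n} \<subseteq> (\<lambda>t. the (?st n t)) ` dom (?st n)"
      using cars by (force simp: ran_def image_iff)
    then have "card {1..n} \<le> card ((\<lambda>t. the (?st n t)) ` dom (?st n))"
      using finite_subset[OF sub] by (intro card_mono) auto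
    also have "\<dots> \<le> card (dom (?st n))" using finite_subset[OF sub] by (intro card_image_le) auto
    finally show "card {1..n} \<le> card (dom (?st n))" .
  qed auto
  have final: "?st n t = (if t \<in> {1..n} then Some (\<sigma> t) else None)" for t
  proof (cases "t \<in> {1..n}")
    case True
    then obtain s where "?st n t = Some s" using dom_n by blast
    then show ?thesis using True fun_cong[OF out, of t] by (simp add: naples_outcome_def)
  next
    case False
    then have "t \<notin> dom (?st n)" using dom_n by blast
    then show ?thesis using False by (auto simp: domIff)
  qed
  have st: "?st c t = Some s \<longleftrightarrow> t \<in> {1..n} \<and> s = \<sigma> t \<and> \<sigma> t \<le> c" if "c \<le> n" for c t s
    using naples_street_restrict[OF pref that order_refl, of k t s] final by auto
  have "naples_spot n k {t \<in> {1..n}. \<sigma> t < \<sigma> i} (\<alpha> (\<sigma> i)) = Some i" if i: "i \<in> {1..n}" for i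
  proof -
    have "\<sigma> i \<in> {1..n}" using permutes_in_image[OF \<sigma>] i by blast
    then obtain c where c: "\<sigma> i = Suc c" "Suc c \<le> n" by (cases "\<sigma> i") auto
    have dom: "dom (?st c) = {t \<in> {1..n}. \<sigma> t < \<sigma> i}" using st[of c] c by (auto simp: dom_def)
    have "?st (Suc c) i = Some (Suc c)" using st[of "Suc c" i "Suc c"] c i by (simp del: naples_street.simps)
    moreover have "?st c i \<noteq> Some (Suc c)" using st[of c] c by auto
    \<comment> \<open>The entry at \<open>i\<close> is present after \<open>Suc c\<close> cars but
      not after \<open>c\<close>, so the car \<open>Suc c\<close> put it there.\<close>
    ultimately have "naples_spot n k (dom (?st c)) (\<alpha> (Suc c)) = Some i"
      by (auto simp: Let_def split: option.splits if_splits)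
    then show ?thesis unfolding dom c(1) .
  qed
  then show "\<alpha> \<in> {\<alpha> \<in> preferences n.
    \<forall>i\<in>{1..n}. naples_spot n k {t \<in> {1..n}. \<sigma> t < \<sigma> i} (\<alpha> (\<sigma> i)) = Some i}"
    using pref by blast
next
  fix \<alpha> assume "\<alpha> \<in> {\<alpha> \<in> preferences n.
    \<forall>i\<in>{1..n}. naples_spot n k {t \<in> {1..n}. \<sigma> t < \<sigma> i} (\<alpha> (\<sigma> i)) = Some i}"
  then have pref: "\<alpha> \<in> preferences n"
    and spot: "\<And>i. i \<in> {1..n} \<Longrightarrow>
      naples_spot n k {t \<in> {1..n}. \<sigma> t < \<sigma> i} (\<alpha> (\<sigma> i)) = Some i" by auto
  let ?st = "naples_street n k \<alpha>"
  have inj: "\<sigma> t = \<sigma> i \<longleftrightarrow> t = i" for t i using permutes_inj[OF \<sigma>] by (auto dest: injD)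
  have img: "\<sigma> t \<in> {1..n} \<longleftrightarrow> t \<in> {1..n}" for t using permutes_in_image[OF \<sigma>] .
  \<comment> \<open>This invariant makes the occupied set met by car \<open>Suc c\<close> exactly
    the one in \<open>spot\<close>, with \<open>i\<close> the spot that \<open>\<sigma>\<close>
    assigns to that car.\<close>
  have st: "?st c = (\<lambda>t. if t \<in> {1..n} \<and> \<sigma> t \<le> c then Some (\<sigma> t) else None)"
    if "c \<le> n" for c
    using that
  proof (induction c)
    case 0
    have "\<not> (t \<in> {1..n} \<and> \<sigma> t \<le> 0)" for t using img[of t] by auto
    then show ?case by (simp only: naples_street.simps if_False not_False_eq_True)
  next
    case (Suc c)
    define i where "i = inv \<sigma> (Suc c)"
    have i: "\<sigma> i = Suc c" unfolding i_def using permutes_inverses(1)[OF \<sigma>] .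
    then have i_in: "i \<in> {1..n}" using img[of i] Suc.prems by simp
    have IH: "?st c = (\<lambda>t. if t \<in> {1..n} \<and> \<sigma> t \<le> c then Some (\<sigma> t) else None)"
      using Suc by simp
    have "dom (?st c) = {t \<in> {1..n}. \<sigma> t < \<sigma> i}"
      unfolding IH i by (auto simp: dom_def)
    then have "?st (Suc c) = (?st c)(i \<mapsto> Suc c)" using spot[OF i_in] i by (simp add: Let_def)
    moreover have "\<sigma> t = Suc c \<longleftrightarrow> t = i" for t using inj[of t i] i by simp
    ultimately show ?case using i_in unfolding IH by (auto simp: i fun_eq_iff le_Suc_eq)
  qed
  have final: "?st n t = (if t \<in> {1..n} then Some (\<sigma> t) else None)" for t
    using st[of n] img[of t] by auto
  have "naples_outcome n k \<alpha> = \<sigma>"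
    using final permutes_not_in[OF \<sigma>] by (auto simp: naples_outcome_def fun_eq_iff)
  moreover have "c \<in> ran (?st n)" if "c \<in> {1..n}" for c
  proof -
    have "\<sigma> (inv \<sigma> c) = c" using permutes_inverses(1)[OF \<sigma>] .
    then have "?st n (inv \<sigma> c) = Some c" using final img[of "inv \<sigma> c"] that by auto
    then show ?thesis by (auto simp: ran_def)
  qed
  ultimately show "\<alpha> \<in> naples_fiber n k \<sigma>"
    using pref by (auto simp: naples_fiber_def naples_PF_def)
qed

text \<open>Preferences are indexed by cars but the intervals by spots, hence the passage through
  \<open>inv \<sigma>\<close>. The product form expresses the independence of the choices.\<close>

lemma naples_fiber_eq_PiE:
  assumes \<sigma>: "\<sigma> permutes {1..n}"
  shows "naples_fiber n k \<sigma> = (\<Pi>\<^sub>E c\<in>{1..n}. let i = inv \<sigma> c in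
    {i + naples_right n k \<sigma> i - naples_ell n k \<sigma> i ..< i + naples_right n k \<sigma> i})"
    (is "_ = ?P")
proof (intro set_eqI)
  fix \<alpha>
  let ?I = "\<lambda>i. {i + naples_right n k \<sigma> i - naples_ell n k \<sigma> i ..< i + naples_right n k \<sigma> i}"
  have img: "\<sigma> i \<in> {1..n} \<longleftrightarrow> i \<in> {1..n}" for i using permutes_in_image[OF \<sigma>] .
  have sub: "?I i \<subseteq> {1..n}" if "i \<in> {1..n}" for i
    using naples_ell_le[of i n k \<sigma>] naples_right_props(3)[of i n k \<sigma>] that by auto
  have bij: "(\<forall>c\<in>{1..n}. Q c (inv \<sigma> c)) \<longleftrightarrow> (\<forall>i\<in>{1..n}. Q (\<sigma> i) i)" for Q
  proof (intro iffI ballI)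
    fix i assume "\<forall>c\<in>{1..n}. Q c (inv \<sigma> c)" "i \<in> {1..n}"
    then have "Q (\<sigma> i) (inv \<sigma> (\<sigma> i))" using img[of i] by blast
    then show "Q (\<sigma> i) i" unfolding permutes_inverses(2)[OF \<sigma>] .
  next
    fix c assume "\<forall>i\<in>{1..n}. Q (\<sigma> i) i" "c \<in> {1..n}"
    then have "Q (\<sigma> (inv \<sigma> c)) (inv \<sigma> c)"
      using permutes_in_image[OF permutes_inv[OF \<sigma>], of c] by blast
    then show "Q c (inv \<sigma> c)" unfolding permutes_inverses(1)[OF \<sigma>] .
  qed
  have pi: "\<alpha> \<in> ?P \<longleftrightarrow> \<alpha> \<in> extensional {1..n} \<and> (\<forall>i\<in>{1..n}. \<alpha> (\<sigma> i) \<in> ?I i)"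
    using bij[of "\<lambda>c i. \<alpha> c \<in> ?I i"] by (auto simp: PiE_def Pi_def Let_def)
  have pref: "\<alpha> \<in> preferences n \<longleftrightarrow>
    \<alpha> \<in> extensional {1..n} \<and> (\<forall>i\<in>{1..n}. \<alpha> (\<sigma> i) \<in> {1..n})"
    using bij[of "\<lambda>c i. \<alpha> c \<in> {1..n}"] by (auto simp: PiE_def Pi_def preferences_def)
  \<comment> \<open>The intervals lie inside \<open>{1..n}\<close>, so membership in them implies
    the range condition of \<open>preferences\<close>.\<close>
  show "\<alpha> \<in> naples_fiber n k \<sigma> \<longleftrightarrow> \<alpha> \<in> ?P"
    unfolding naples_fiber_eq[OF \<sigma>] pi mem_Collect_eq pref
    using naples_spot_eq_Some_iff_interval[OF \<sigma>] sub by blast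
qed

section \<open>Area and generating function\<close>

text \<open>A summand of the area combines spot \<open>i\<close> with the preference of car
  \<open>i\<close>, which are unrelated. Rearranging the total by cars makes each term the distance
  of a preference from the largest admissible one, a natural number.\<close>

lemma naples_area_fiber:
  assumes \<sigma>: "\<sigma> permutes {1..n}" and p: "p \<in> naples_fiber n k \<sigma>"
  shows "naples_area n k p =
    int (\<Sum>c=1..n. inv \<sigma> c + naples_right n k \<sigma> (inv \<sigma> c) - 1 - p c)"
proof -
  let ?R = "naples_right n k \<sigma>"
  have out: "naples_outcome n k p = \<sigma>" using p by (simp add: naples_fiber_def)
  have lt: "p c < inv \<sigma> c + ?R (inv \<sigma> c)" if "c \<in> {1..n}" for c
    using PiE_mem[OF p[unfolded naples_fiber_eq_PiE[OF \<sigma>]] that] by (simp add: Let_def)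
  have "int (\<Sum>c=1..n. inv \<sigma> c + ?R (inv \<sigma> c) - 1 - p c)
      = (\<Sum>c=1..n. int (inv \<sigma> c) - 1 + int (?R (inv \<sigma> c)) - int (p c))"
    unfolding of_nat_sum
  proof (rule sum.cong[OF refl])
    fix c assume "c \<in> {1..n}"
    from lt[OF this] show "int (inv \<sigma> c + ?R (inv \<sigma> c) - 1 - p c)
      = int (inv \<sigma> c) - 1 + int (?R (inv \<sigma> c)) - int (p c)" by linarith
  qed
  also have "\<dots> = (\<Sum>c=1..n. int (inv \<sigma> c) - 1 + int (?R (inv \<sigma> c))) - (\<Sum>c=1..n. int (p c))"
    by (rule sum_subtractf)
  also have "(\<Sum>c=1..n. int (inv \<sigma> c) - 1 + int (?R (inv \<sigma> c)))
      = (\<Sum>i=1..n. int i - 1 + int (?R i))"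
    using sum.permute[OF permutes_inv[OF \<sigma>], of "\<lambda>i. int i - 1 + int (?R i)"]
    by (simp add: o_def)
  also have "\<dots> = (\<Sum>i=1..n. int i - 1) + (\<Sum>i=1..n. int (?R i))"
    by (rule sum.distrib)
  \<comment> \<open>Reversing the street turns the position offsets \<open>i - 1\<close> into the
    \<open>n - i\<close> of the area.\<close>
  also have "(\<Sum>i=1..n. int i - 1) = (\<Sum>i=1..n. int n - int i)"
    by (rule sum.reindex_bij_witness[of _ "\<lambda>i. n + 1 - i" "\<lambda>i. n + 1 - i"]) auto
  finally show ?thesis
    unfolding naples_area_def out by (simp only: sum.distrib sum_subtractf)
qed

theorem proposition5p8:
  fixes n k :: nat and \<sigma> :: "nat \<Rightarrow> nat"
  assumes "n \<ge> 1" and "k \<le> n - 1" and "\<sigma> permutes {1..n}"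
  shows "(\<Sum>p\<in>naples_fiber n k \<sigma>. q_indet powi naples_area n k p)
       = (\<Prod>i=1..n. q_number q_indet (naples_ell n k \<sigma> i))"
proof -
  note \<sigma> = assms(3)
  let ?R = "naples_right n k \<sigma>" and ?l = "naples_ell n k \<sigma>"
  let ?I = "\<lambda>i. {i + ?R i - ?l i ..< i + ?R i}"
  have "(\<Sum>p\<in>naples_fiber n k \<sigma>. q_indet powi naples_area n k p)
      = (\<Sum>p\<in>naples_fiber n k \<sigma>. \<Prod>c=1..n. q_indet ^ (inv \<sigma> c + ?R (inv \<sigma> c) - 1 - p c))"
    by (intro sum.cong refl) (simp only: naples_area_fiber[OF \<sigma>] power_int_of_nat power_sum)
  \<comment> \<open>Distributivity: the fiber is a product set and each factor depends on one
    preference only.\<close>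
  also have "\<dots> = (\<Prod>c=1..n. \<Sum>a\<in>?I (inv \<sigma> c). q_indet ^ (inv \<sigma> c + ?R (inv \<sigma> c) - 1 - a))"
    unfolding naples_fiber_eq_PiE[OF \<sigma>] Let_def
    by (rule prod_sum_PiE[symmetric]) auto
  also have "\<dots> = (\<Prod>i=1..n. \<Sum>a\<in>?I i. q_indet ^ (i + ?R i - 1 - a))"
    using prod.permute[OF permutes_inv[OF \<sigma>],
      of "\<lambda>i. \<Sum>a\<in>?I i. q_indet ^ (i + ?R i - 1 - a)"]
    by (simp add: o_def)
  also have "\<dots> = (\<Prod>i=1..n. q_number q_indet (?l i))"
  proof (rule prod.cong)
    fix i assume "i \<in> {1..n}"
    then have "?l i + 1 \<le> i + ?R i" by (intro naples_ell_le) auto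
    \<comment> \<open>Counting down from the largest preference, which gets exponent 0, matches the
      interval with the exponents below \<open>?l i\<close>.\<close>
    then show "(\<Sum>a\<in>?I i. q_indet ^ (i + ?R i - 1 - a)) = q_number q_indet (?l i)"
      unfolding q_number_def
      by (intro sum.reindex_bij_witness[of _ "\<lambda>j. i + ?R i - 1 - j" "\<lambda>a. i + ?R i - 1 - a"]) auto
  qed simp
  finally show ?thesis .
qed

end
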